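(* Let $U_1,\dots,U_L$ and $V$ be unitaries on $(\mathbb{C}^2)^{\otimes n}$, and consider operators on $(\mathbb{C}^2)^{\otimes n}\otimes\mathbb{C}^{L+1}$ (register $\otimes$ clock). Let $$\mathcal{H}_{\rm in}=V\Bigl(\sum_{i=1}^nP_1^{(i)}\Bigr)V^\dagger\otimes P_0 ,\qquad \mathcal{H}_{\rm prop}=\sum_{t=1}^L\mathcal{H}_t .$$ Then adding $\mathcal{H}_{\rm in}$ lifts the degeneracy of the ground space of $\mathcal{H}_{\rm prop}$: for all real $J,K>0$, the history state with fixed input $$\frac{1}{\sqrt{L+1}}\sum_{t=0}^{L}U_t\cdots U_1\,(V|0\rangle^{\otimes n})\otimes|t\rangle$$ is the non-degenerate ground state of $J\,\mathcal{H}_{\rm in}+K\,\mathcal{H}_{\rm prop}$.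
   Context: The clock space $\mathbb{C}^{L+1}$ has orthonormal basis $|0\rangle,\dots,|L\rangle$. In $\mathcal{H}_{\rm in}$, $P_1^{(i)}=|1\rangle\langle1|$ acts on register qubit $i$ and $P_0=|0\rangle\langle0|$ acts on the clock space. The propagation terms are $$\mathcal{H}_t=\tfrac12\Bigl(-U_t\otimes|t\rangle\langle t-1|-U_t^\dagger\otimes|t-1\rangle\langle t|+\mathbb{1}\otimes|t\rangle\langle t|+\mathbb{1}\otimes|t-1\rangle\langle t-1|\Bigr).$$ For $t=0$ the product $U_t\cdots U_1$ is the identity. Non-degenerate means that the lowest eigenspace is one-dimensional. *)

theory Defs
  imports
    "Jordan_Normal_Form.Matrix_Kernel"
    "Jordan_Normal_Form.Char_Poly"
    "Jordan_Normal_Form.Schur_Decomposition"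
begin

definition unitary_mat :: "nat \<Rightarrow> complex mat \<Rightarrow> bool" where
  "unitary_mat d U \<longleftrightarrow>
     U \<in> carrier_mat d d \<and> mat_adjoint U * U = 1\<^sub>m d \<and> U * mat_adjoint U = 1\<^sub>m d"

(* Tensor products are Kronecker products: the basis vector e_i (x) e_j of C^a (x) C^b
   has index i * b + j. *)
definition kron_mat :: "complex mat \<Rightarrow> complex mat \<Rightarrow> complex mat" (infixr \<open>\<otimes>\<^sub>m\<close> 75) where
  "A \<otimes>\<^sub>m B = mat (dim_row A * dim_row B) (dim_col A * dim_col B)
     (\<lambda>(i, j). A $$ (i div dim_row B, j div dim_col B) * B $$ (i mod dim_row B, j mod dim_col B))"

definition kron_vec :: "complex vec \<Rightarrow> complex vec \<Rightarrow> complex vec" (infixr \<open>\<otimes>\<^sub>v\<close> 75) where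
  "u \<otimes>\<^sub>v v = vec (dim_vec u * dim_vec v) (\<lambda>i. u $ (i div dim_vec v) * v $ (i mod dim_vec v))"

primrec tensor_power_vec :: "complex vec \<Rightarrow> nat \<Rightarrow> complex vec" where
  "tensor_power_vec v 0 = unit_vec 1 0"
| "tensor_power_vec v (Suc n) = v \<otimes>\<^sub>v tensor_power_vec v n"

definition ketbra :: "nat \<Rightarrow> nat \<Rightarrow> nat \<Rightarrow> complex mat" where
  "ketbra d i j = mat d d (\<lambda>(a, b). unit_vec d i $ a * cnj (unit_vec d j $ b))"

abbreviation msum :: "nat \<Rightarrow> ('i \<Rightarrow> complex mat) \<Rightarrow> 'i set \<Rightarrow> complex mat" where
  "msum d f I \<equiv> finsum (module_mat TYPE(complex) d d) f I"

abbreviation vsum :: "nat \<Rightarrow> ('i \<Rightarrow> complex vec) \<Rightarrow> 'i set \<Rightarrow> complex vec" where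
  "vsum d f I \<equiv> finsum (module_vec TYPE(complex) d) f I"

(* Qubits are numbered 1, ..., n, qubit 1 being the leftmost tensor factor. *)
definition P1 :: "nat \<Rightarrow> nat \<Rightarrow> complex mat" where
  "P1 n i = 1\<^sub>m (2 ^ (i - 1)) \<otimes>\<^sub>m ketbra 2 1 1 \<otimes>\<^sub>m 1\<^sub>m (2 ^ (n - i))"

definition H_in :: "nat \<Rightarrow> nat \<Rightarrow> complex mat \<Rightarrow> complex mat" where
  "H_in n L V = (V * msum (2 ^ n) (P1 n) {1..n} * mat_adjoint V) \<otimes>\<^sub>m ketbra (L + 1) 0 0"

definition H_step :: "nat \<Rightarrow> nat \<Rightarrow> (nat \<Rightarrow> complex mat) \<Rightarrow> nat \<Rightarrow> complex mat" where
  "H_step n L U t = (1 / 2) \<cdot>\<^sub>m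
     (- (U t \<otimes>\<^sub>m ketbra (L + 1) t (t - 1))
      - mat_adjoint (U t) \<otimes>\<^sub>m ketbra (L + 1) (t - 1) t
      + 1\<^sub>m (2 ^ n) \<otimes>\<^sub>m ketbra (L + 1) t t
      + 1\<^sub>m (2 ^ n) \<otimes>\<^sub>m ketbra (L + 1) (t - 1) (t - 1))"

definition H_prop :: "nat \<Rightarrow> nat \<Rightarrow> (nat \<Rightarrow> complex mat) \<Rightarrow> complex mat" where
  "H_prop n L U = msum (2 ^ n * (L + 1)) (H_step n L U) {1..L}"

primrec U_prod :: "nat \<Rightarrow> (nat \<Rightarrow> complex mat) \<Rightarrow> nat \<Rightarrow> complex mat" where
  "U_prod n U 0 = 1\<^sub>m (2 ^ n)"
| "U_prod n U (Suc t) = U (Suc t) * U_prod n U t"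

definition history_state ::
  "nat \<Rightarrow> nat \<Rightarrow> (nat \<Rightarrow> complex mat) \<Rightarrow> complex vec \<Rightarrow> complex vec" where
  "history_state n L U \<phi> = complex_of_real (1 / sqrt (real (L + 1))) \<cdot>\<^sub>v
     vsum (2 ^ n * (L + 1)) (\<lambda>t. (U_prod n U t *\<^sub>v \<phi>) \<otimes>\<^sub>v unit_vec (L + 1) t) {0..L}"

definition lowest_eigenvalue :: "complex mat \<Rightarrow> real \<Rightarrow> bool" where
  "lowest_eigenvalue H E \<longleftrightarrow>
     eigenvalue H (complex_of_real E) \<and> (\<forall>k. eigenvalue H k \<longrightarrow> k \<in> \<real> \<and> E \<le> Re k)"

(* kernel_dim (char_matrix H k) is the dimension of the eigenspace of H for k. *)
definition degenerate_ground_space :: "complex mat \<Rightarrow> bool" where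
  "degenerate_ground_space H \<longleftrightarrow>
     (\<exists>E. lowest_eigenvalue H E \<and> kernel_dim (char_matrix H (complex_of_real E)) > 1)"

definition nondegenerate_ground_state :: "complex mat \<Rightarrow> complex vec \<Rightarrow> bool" where
  "nondegenerate_ground_state H \<psi> \<longleftrightarrow> \<psi> \<bullet>c \<psi> = 1 \<and>
     (\<exists>E. lowest_eigenvalue H E \<and> eigenvector H \<psi> (complex_of_real E) \<and>
          kernel_dim (char_matrix H (complex_of_real E)) = 1)"

end

theory Submission
  imports Defs
begin

text \<open>Write \<open>w\<^sub>t\<close> for the component of a vector \<open>w\<close> at clock value \<open>t\<close>. The form of the \<open>t\<close>-th
  propagation term is \<open>\<parallel>w\<^sub>t - U\<^sub>t w\<^bsub>t-1\<^esub>\<parallel>\<^sup>2 / 2\<close>, so the propagation Hamiltonian is positive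
  semidefinite and its kernel consists of the history states \<open>w\<^sub>t = U\<^sub>t \<dots> U\<^sub>1 w\<^sub>0\<close> with \<open>w\<^sub>0\<close>
  arbitrary; it has dimension \<open>2\<^sup>n\<close>. The input term is positive semidefinite too, and annihilates
  \<open>w\<close> iff no bit is set in any basis vector occurring in \<open>V\<^sup>\<dagger> w\<^sub>0\<close>, i.e. iff \<open>w\<^sub>0\<close> is a multiple
  of \<open>V|0\<dots>0\<rangle>\<close>. For positive \<open>J\<close>, \<open>K\<close> the kernel of the sum is the intersection of the kernels,
  which is one-dimensional.\<close>

section \<open>Kernels of dimension one and of dimension at least two\<close>

lemma kernel_dim_eq_1I:
  fixes A :: "'a :: field mat"
  assumes A: "A \<in> carrier_mat nr nc" and v: "v \<in> mat_kernel A" "v \<noteq> 0\<^sub>v nc"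
    and multiple: "\<And>w. w \<in> mat_kernel A \<Longrightarrow> \<exists>c. w = c \<cdot>\<^sub>v v"
  shows "kernel_dim A = 1"
proof -
  interpret kernel nr nc A by (unfold_locales, rule A)
  have "w \<in> span {v}" if w: "w \<in> mat_kernel A" for w
  proof -
    obtain c where c: "w = c \<cdot>\<^sub>v v" using multiple[OF w] by blast
    have "v \<in> span {v}" using Ker.in_own_span[of "{v}"] v by auto
    then show ?thesis unfolding c
      using Ker.span_is_submodule[of "{v}"] v by (auto simp: submodule_def class_ring_simps)
  qed
  moreover have "span {v} \<subseteq> mat_kernel A"
    using Ker.span_is_subset2[of "{v}"] v by simp
  ultimately have "gen_set {v}" by auto
  then show ?thesis using Ker.dim1I[of v] v by (simp add: kernel_dim)
qed

text \<open>Independence is phrased through coefficients so that \<open>x \<noteq> y\<close> can be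
  derived, from the coefficients 1 and -1. Then \<open>{x, y}\<close> is an independent set with two
  elements inside the kernel.\<close>

lemma kernel_dim_gt_1I:
  fixes A :: "'a :: field mat"
  assumes A: "A \<in> carrier_mat nr nc" and x: "x \<in> mat_kernel A" and y: "y \<in> mat_kernel A"
    and indep: "\<And>a b. a \<cdot>\<^sub>v x + b \<cdot>\<^sub>v y = 0\<^sub>v nc \<Longrightarrow> a = 0 \<and> b = 0"
  shows "kernel_dim A > 1"
proof -
  interpret kernel nr nc A by (unfold_locales, rule A)
  have xc: "x \<in> carrier_vec nc" and yc: "y \<in> carrier_vec nc"
    using x y A by (auto dest: mat_kernelD)
  have "x \<noteq> y"
  proof
    assume "x = y"
    then have "1 \<cdot>\<^sub>v x + (- 1) \<cdot>\<^sub>v y = 0\<^sub>v nc" using yc by (intro eq_vecI) auto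
    then show False using indep by fastforce
  qed
  have "lin_indpt {x, y}"
  proof (rule Ker.finite_lin_indpt2)
    fix a assume "lincomb a {x, y} = 0\<^sub>v nc"
    \<comment> \<open>The combination formed in the kernel as a space of its own agrees with the one
      in the ambient space \<open>NC\<close>, where it can be expanded.\<close>
    then have "NC.lincomb a {x, y} = 0\<^sub>v nc" using lincomb_same x y by simp
    then have "a x \<cdot>\<^sub>v x + a y \<cdot>\<^sub>v y = 0\<^sub>v nc"
      using \<open>x \<noteq> y\<close> xc yc by (simp add: NC.lincomb_def NC.finsum_insert module_vec_simps)
    then show "\<forall>v\<in>{x, y}. a v = 0" using indep by simp
  qed (use x y in auto)
  moreover have "Ker.fin_dim"
    using kernel_basis_exists[OF A] by (auto simp: Ker.fin_dim_def Ker.basis_def)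
  ultimately have "card {x, y} \<le> dim" using Ker.li_le_dim(2)[of "{x, y}"] x y by simp
  then show ?thesis using \<open>x \<noteq> y\<close> by (simp add: kernel_dim)
qed

section \<open>Adjoints and positive semidefinite matrices\<close>

lemma mat_adjoint_carrier: "A \<in> carrier_mat nr nc \<Longrightarrow> mat_adjoint A \<in> carrier_mat nc nr"
  by (auto simp: mat_adjoint_def)

lemma mat_adjoint_index:
  "A \<in> carrier_mat nr nc \<Longrightarrow> i < nc \<Longrightarrow> j < nr \<Longrightarrow> mat_adjoint A $$ (i, j) = conjugate (A $$ (j, i))"
  by (auto simp: mat_adjoint_def mat_of_rows_def)

text \<open>The product \<open>\<bullet>c\<close> conjugates its second argument, so after
  exchanging the two sums the conjugated entries of \<open>A\<close> are those of the
  adjoint.\<close>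

lemma cscalar_prod_mult_mat_vec_left:
  fixes A :: "complex mat"
  assumes A: "A \<in> carrier_mat nr nc" and x: "x \<in> carrier_vec nc" and y: "y \<in> carrier_vec nr"
  shows "(A *\<^sub>v x) \<bullet>c y = x \<bullet>c (mat_adjoint A *\<^sub>v y)"
proof -
  have "(A *\<^sub>v x) \<bullet>c y = (\<Sum>i<nr. \<Sum>j<nc. A $$ (i, j) * x $ j * cnj (y $ i))"
    using assms by (simp add: scalar_prod_def sum_distrib_right lessThan_atLeast0)
  also have "\<dots> = (\<Sum>j<nc. \<Sum>i<nr. A $$ (i, j) * x $ j * cnj (y $ i))"
    by (rule sum.swap)
  also have "\<dots> = x \<bullet>c (mat_adjoint A *\<^sub>v y)"
    using assms mat_adjoint_carrier[OF A]
    by (simp add: scalar_prod_def sum_distrib_left lessThan_atLeast0 mat_adjoint_index[OF A] ac_simps)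
  finally show ?thesis .
qed

text \<open>For a positive semidefinite matrix the implication from a vanishing form to a vanishing image
  follows from Cauchy--Schwarz; building it into the definition makes the notion closed under sums,
  with the kernel of a sum equal to the intersection of the kernels, without that argument.\<close>

definition psd_mat :: "nat \<Rightarrow> complex mat \<Rightarrow> bool" where
  "psd_mat d A \<longleftrightarrow> A \<in> carrier_mat d d \<and>
     (\<forall>w \<in> carrier_vec d. 0 \<le> (A *\<^sub>v w) \<bullet>c w \<and> ((A *\<^sub>v w) \<bullet>c w = 0 \<longrightarrow> A *\<^sub>v w = 0\<^sub>v d))"

lemma psd_matI:
  assumes "A \<in> carrier_mat d d"
    and "\<And>w. w \<in> carrier_vec d \<Longrightarrow> 0 \<le> (A *\<^sub>v w) \<bullet>c w"
    and "\<And>w. w \<in> carrier_vec d \<Longrightarrow> (A *\<^sub>v w) \<bullet>c w = 0 \<Longrightarrow> A *\<^sub>v w = 0\<^sub>v d"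
  shows "psd_mat d A"
  using assms by (simp add: psd_mat_def)

lemma psd_matD:
  assumes "psd_mat d A"
  shows "A \<in> carrier_mat d d"
    and "w \<in> carrier_vec d \<Longrightarrow> 0 \<le> (A *\<^sub>v w) \<bullet>c w"
    and "w \<in> carrier_vec d \<Longrightarrow> (A *\<^sub>v w) \<bullet>c w = 0 \<Longrightarrow> A *\<^sub>v w = 0\<^sub>v d"
  using assms by (auto simp: psd_mat_def)

lemma zero_mult_mat_vec:
  "w \<in> carrier_vec nc \<Longrightarrow> 0\<^sub>m nr nc *\<^sub>v w = (0\<^sub>v nr :: 'a :: semiring_0 vec)"
  by (intro eq_vecI) auto

lemma psd_mat_zero: "psd_mat d (0\<^sub>m d d)"
  by (rule psd_matI) (auto simp: zero_mult_mat_vec)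

text \<open>The two forms are nonnegative, so their sum vanishes only if both do, and then both
  images vanish by definition.\<close>

lemma psd_mat_add:
  assumes A: "psd_mat d A" and B: "psd_mat d B"
  shows "psd_mat d (A + B)"
    and "w \<in> carrier_vec d \<Longrightarrow> (A + B) *\<^sub>v w = 0\<^sub>v d \<longleftrightarrow> A *\<^sub>v w = 0\<^sub>v d \<and> B *\<^sub>v w = 0\<^sub>v d"
proof -
  note carr = psd_matD(1)[OF A] psd_matD(1)[OF B]
  have split: "((A + B) *\<^sub>v w) \<bullet>c w = (A *\<^sub>v w) \<bullet>c w + (B *\<^sub>v w) \<bullet>c w" if w: "w \<in> carrier_vec d" for w
    using add_mult_distrib_mat_vec[OF carr w] carr w
    by (simp add: add_scalar_prod_distrib[of _ d])
  have both: "A *\<^sub>v w = 0\<^sub>v d \<and> B *\<^sub>v w = 0\<^sub>v d"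
    if w: "w \<in> carrier_vec d" and "((A + B) *\<^sub>v w) \<bullet>c w = 0" for w
    using that split[OF w] psd_matD(2,3)[OF A w] psd_matD(2,3)[OF B w]
    by (simp add: add_nonneg_eq_0_iff)
  have sum0: "(A + B) *\<^sub>v w = 0\<^sub>v d"
    if "w \<in> carrier_vec d" "A *\<^sub>v w = 0\<^sub>v d" "B *\<^sub>v w = 0\<^sub>v d" for w
    using add_mult_distrib_mat_vec[OF carr] that by simp
  show "psd_mat d (A + B)"
  proof (rule psd_matI)
    fix w :: "complex vec" assume w: "w \<in> carrier_vec d"
    show "0 \<le> ((A + B) *\<^sub>v w) \<bullet>c w"
      using psd_matD(2)[OF A w] psd_matD(2)[OF B w] by (simp add: split[OF w])
    show "(A + B) *\<^sub>v w = 0\<^sub>v d" if "((A + B) *\<^sub>v w) \<bullet>c w = 0"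
      using both[OF w that] sum0[OF w] by simp
  qed (use carr in simp)
  show "(A + B) *\<^sub>v w = 0\<^sub>v d \<longleftrightarrow> A *\<^sub>v w = 0\<^sub>v d \<and> B *\<^sub>v w = 0\<^sub>v d" if w: "w \<in> carrier_vec d"
    using both[OF w] sum0[OF w] w by auto
qed

lemma smult_mult_mat_vec:
  fixes A :: "'a :: comm_ring_1 mat"
  assumes "A \<in> carrier_mat nr nc" "w \<in> carrier_vec nc"
  shows "(c \<cdot>\<^sub>m A) *\<^sub>v w = c \<cdot>\<^sub>v (A *\<^sub>v w)"
  using assms by (intro eq_vecI) auto

lemma smult_vec_eq_0_iff:
  fixes c :: "'a :: field"
  assumes "w \<in> carrier_vec d" "c \<noteq> 0"
  shows "c \<cdot>\<^sub>v w = 0\<^sub>v d \<longleftrightarrow> w = 0\<^sub>v d"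
  using assms by (auto simp: vec_eq_iff)

text \<open>Strict positivity of \<open>r\<close> is what leaves the kernel unchanged; the
  assumptions on \<open>J\<close> and \<open>K\<close> enter the argument here.\<close>

lemma psd_mat_smult:
  assumes A: "psd_mat d A" and r: "r > 0"
  shows "psd_mat d (complex_of_real r \<cdot>\<^sub>m A)"
    and "w \<in> carrier_vec d \<Longrightarrow> (complex_of_real r \<cdot>\<^sub>m A) *\<^sub>v w = 0\<^sub>v d \<longleftrightarrow> A *\<^sub>v w = 0\<^sub>v d"
proof -
  note carr = psd_matD(1)[OF A]
  show ker: "(complex_of_real r \<cdot>\<^sub>m A) *\<^sub>v w = 0\<^sub>v d \<longleftrightarrow> A *\<^sub>v w = 0\<^sub>v d" if "w \<in> carrier_vec d" for w
    using that carr r by (simp add: smult_mult_mat_vec[OF carr] smult_vec_eq_0_iff)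
  have form: "((complex_of_real r \<cdot>\<^sub>m A) *\<^sub>v w) \<bullet>c w = complex_of_real r * ((A *\<^sub>v w) \<bullet>c w)"
    if "w \<in> carrier_vec d" for w
    using that carr by (simp add: smult_mult_mat_vec[OF carr])
  show "psd_mat d (complex_of_real r \<cdot>\<^sub>m A)"
  proof (rule psd_matI)
    fix w :: "complex vec" assume w: "w \<in> carrier_vec d"
    show "0 \<le> ((complex_of_real r \<cdot>\<^sub>m A) *\<^sub>v w) \<bullet>c w"
      unfolding form[OF w] using psd_matD(2)[OF A w] r
      by (intro mult_nonneg_nonneg) (auto simp: less_eq_complex_def)
    show "(complex_of_real r \<cdot>\<^sub>m A) *\<^sub>v w = 0\<^sub>v d" if "((complex_of_real r \<cdot>\<^sub>m A) *\<^sub>v w) \<bullet>c w = 0"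
      using that psd_matD(3)[OF A w] r unfolding form[OF w] ker[OF w] by simp
  qed (use carr in simp)
qed

lemma psd_mat_msum:
  assumes "finite I" and "\<And>i. i \<in> I \<Longrightarrow> psd_mat d (f i)"
  shows "psd_mat d (msum d f I)"
    and "w \<in> carrier_vec d \<Longrightarrow> msum d f I *\<^sub>v w = 0\<^sub>v d \<longleftrightarrow> (\<forall>i\<in>I. f i *\<^sub>v w = 0\<^sub>v d)"
proof -
  interpret M: abelian_group "module_mat TYPE(complex) d d" by (rule abelian_group_mat)
  \<comment> \<open>Both claims go into one induction: the kernel of the larger sum is an
    intersection only because the smaller sum is known to be semidefinite.\<close>
  have *: "psd_mat d (msum d f I) \<and>
    (\<forall>w\<in>carrier_vec d. msum d f I *\<^sub>v w = 0\<^sub>v d \<longleftrightarrow> (\<forall>i\<in>I. f i *\<^sub>v w = 0\<^sub>v d))"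
    using assms
  proof (induction I)
    case empty
    then show ?case by (simp add: module_mat_simps psd_mat_zero zero_mult_mat_vec)
  next
    case (insert i I)
    have "msum d f (insert i I) = f i + msum d f I"
      using insert.hyps insert.prems
      by (subst M.finsum_insert) (auto simp: module_mat_simps dest: psd_matD(1))
    then show ?case using insert psd_mat_add[of d "f i" "msum d f I"] by simp
  qed
  show "psd_mat d (msum d f I)" using * by simp
  show "msum d f I *\<^sub>v w = 0\<^sub>v d \<longleftrightarrow> (\<forall>i\<in>I. f i *\<^sub>v w = 0\<^sub>v d)" if "w \<in> carrier_vec d"
    using * that by simp
qed

text \<open>The form at \<open>w\<close> is the form of \<open>A\<close> at
  \<open>mat_adjoint V\<close> applied to \<open>w\<close>, and the outer factor \<open>V\<close> is
  injective, so it does not enlarge the kernel.\<close>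

lemma psd_mat_conj:
  assumes A: "psd_mat d A" and V: "unitary_mat d V"
  shows "psd_mat d (V * A * mat_adjoint V)"
    and "w \<in> carrier_vec d \<Longrightarrow>
      (V * A * mat_adjoint V) *\<^sub>v w = 0\<^sub>v d \<longleftrightarrow> A *\<^sub>v (mat_adjoint V *\<^sub>v w) = 0\<^sub>v d"
proof -
  let ?V' = "mat_adjoint V"
  have V': "V \<in> carrier_mat d d" "?V' \<in> carrier_mat d d" "?V' * V = 1\<^sub>m d"
    using V mat_adjoint_carrier by (auto simp: unitary_mat_def)
  note carr = psd_matD(1)[OF A]
  have app: "(V * A * ?V') *\<^sub>v w = V *\<^sub>v (A *\<^sub>v (?V' *\<^sub>v w))" if "w \<in> carrier_vec d" for w
    using that carr V' by (simp add: assoc_mult_mat_vec[of _ d d _ d])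
  have form: "((V * A * ?V') *\<^sub>v w) \<bullet>c w = (A *\<^sub>v (?V' *\<^sub>v w)) \<bullet>c (?V' *\<^sub>v w)"
    if w: "w \<in> carrier_vec d" for w
    unfolding app[OF w]
    using w carr V' by (intro cscalar_prod_mult_mat_vec_left) auto
  have V0: "V *\<^sub>v 0\<^sub>v d = 0\<^sub>v d" "?V' *\<^sub>v 0\<^sub>v d = 0\<^sub>v d" using V' by auto
  have inj: "x = 0\<^sub>v d" if "V *\<^sub>v x = 0\<^sub>v d" "x \<in> carrier_vec d" for x
    using that V' V0 assoc_mult_mat_vec[of ?V' d d V d x] by simp
  show ker: "(V * A * ?V') *\<^sub>v w = 0\<^sub>v d \<longleftrightarrow> A *\<^sub>v (?V' *\<^sub>v w) = 0\<^sub>v d" if w: "w \<in> carrier_vec d" for w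
    unfolding app[OF w] using inj[of "A *\<^sub>v (?V' *\<^sub>v w)"] V0 V' w carr by auto
  show "psd_mat d (V * A * ?V')"
  proof (rule psd_matI)
    fix w :: "complex vec" assume w: "w \<in> carrier_vec d"
    have w': "?V' *\<^sub>v w \<in> carrier_vec d" using V' w by simp
    show "0 \<le> ((V * A * ?V') *\<^sub>v w) \<bullet>c w"
      unfolding form[OF w] by (rule psd_matD(2)[OF A w'])
    show "(V * A * ?V') *\<^sub>v w = 0\<^sub>v d" if "((V * A * ?V') *\<^sub>v w) \<bullet>c w = 0"
      using that psd_matD(3)[OF A w'] unfolding form[OF w] ker[OF w] by simp
  qed (use carr V' in simp)
qed

text \<open>In the order on complex numbers \<open>0 \<le> k\<close> includes that \<open>k\<close>
  is real, which \<open>lowest_eigenvalue\<close> demands besides the bound. It results from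
  cancelling the positive factor \<open>v \<bullet>c v\<close> in the form at an
  eigenvector.\<close>

lemma psd_mat_eigenvalue:
  assumes A: "psd_mat d A" and k: "eigenvalue A k"
  shows "0 \<le> k"
proof -
  note carr = psd_matD(1)[OF A]
  obtain v where v: "v \<in> carrier_vec d" "v \<noteq> 0\<^sub>v d" "A *\<^sub>v v = k \<cdot>\<^sub>v v"
    using k carr by (auto simp: eigenvalue_def eigenvector_def)
  have "0 \<le> k * (v \<bullet>c v)" using psd_matD(2)[OF A v(1)] v by simp
  moreover have "v \<bullet>c v > 0" using v by simp
  ultimately show ?thesis
    by (auto simp: less_eq_complex_def less_complex_def zero_le_mult_iff)
qed

lemma psd_mat_lowest_eigenvalue:
  assumes A: "psd_mat d A" and v: "v \<in> carrier_vec d" "v \<noteq> 0\<^sub>v d" "A *\<^sub>v v = 0\<^sub>v d"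
  shows "eigenvector A v 0" and "lowest_eigenvalue A 0"
proof -
  have "0 \<cdot>\<^sub>v v = 0\<^sub>v d" using v by auto
  then show "eigenvector A v 0" using psd_matD(1)[OF A] v by (auto simp: eigenvector_def)
  then show "lowest_eigenvalue A 0"
    using psd_mat_eigenvalue[OF A]
    by (auto simp: lowest_eigenvalue_def eigenvalue_def less_eq_complex_def complex_is_Real_iff)
qed

text \<open>The ground energy is 0 throughout, so the eigenspace dimension becomes the kernel
  dimension of the Hamiltonian itself.\<close>

lemma char_matrix_0: "A \<in> carrier_mat d d \<Longrightarrow> char_matrix A 0 = A"
  by (intro eq_matI) (auto simp: char_matrix_def)

section \<open>Slicing vectors by clock value\<close>

text \<open>The register component of \<open>w\<close> at clock value \<open>t\<close>, i.e. \<open>(1 \<otimes> \<langle>t|) w\<close>, for a clock of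
  dimension \<open>m\<close>.\<close>

definition clock_slice :: "nat \<Rightarrow> nat \<Rightarrow> complex vec \<Rightarrow> nat \<Rightarrow> complex vec" where
  "clock_slice N m w t = vec N (\<lambda>i. w $ (i * m + t))"

lemma clock_slice_carrier [simp]: "clock_slice N m w t \<in> carrier_vec N"
  by (simp add: clock_slice_def)

lemma dim_clock_slice [simp]: "dim_vec (clock_slice N m w t) = N"
  by (simp add: clock_slice_def)

lemma mult_add_less:
  fixes i t :: nat
  assumes "i < N" "t < m"
  shows "i * m + t < N * m"
proof -
  have "i * m + t < Suc i * m" using assms by simp
  also have "\<dots> \<le> N * m" using assms by (intro mult_right_mono) auto
  finally show ?thesis .
qed

text \<open>The range is cut into \<open>N\<close> blocks of length \<open>m\<close>:
  \<open>i\<close> is the register index and \<open>t\<close> the clock value.\<close>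

lemma sum_lessThan_mult:
  fixes f :: "nat \<Rightarrow> 'a :: comm_monoid_add"
  shows "(\<Sum>k<N * m. f k) = (\<Sum>i<N. \<Sum>t<m. f (i * m + t))"
proof -
  have "(\<Sum>k<N * m. f k) = (\<Sum>i<N. sum f {i * m..<i * m + m})"
    by (simp add: sum.nat_group)
  also have "\<dots> = (\<Sum>i<N. \<Sum>t<m. f (i * m + t))"
  proof (rule sum.cong[OF refl])
    fix i
    show "sum f {i * m..<i * m + m} = (\<Sum>t<m. f (i * m + t))"
      using sum.shift_bounds_nat_ivl[of f 0 "i * m" m] by (simp add: lessThan_atLeast0 add.commute)
  qed
  finally show ?thesis .
qed

lemma clock_slice_add:
  assumes "v \<in> carrier_vec (N * m)" "w \<in> carrier_vec (N * m)" "t < m"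
  shows "clock_slice N m (v + w) t = clock_slice N m v t + clock_slice N m w t"
  using assms by (intro eq_vecI) (auto simp: clock_slice_def mult_add_less)

lemma clock_slice_minus:
  assumes "v \<in> carrier_vec (N * m)" "w \<in> carrier_vec (N * m)" "t < m"
  shows "clock_slice N m (v - w) t = clock_slice N m v t - clock_slice N m w t"
  using assms by (intro eq_vecI) (auto simp: clock_slice_def mult_add_less)

lemma clock_slice_uminus:
  assumes "w \<in> carrier_vec (N * m)" "t < m"
  shows "clock_slice N m (- w) t = - clock_slice N m w t"
  using assms by (intro eq_vecI) (auto simp: clock_slice_def mult_add_less)

lemma clock_slice_smult:
  assumes "w \<in> carrier_vec (N * m)" "t < m"
  shows "clock_slice N m (c \<cdot>\<^sub>v w) t = c \<cdot>\<^sub>v clock_slice N m w t"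
  using assms by (intro eq_vecI) (auto simp: clock_slice_def mult_add_less)

lemma clock_slice_zero: "t < m \<Longrightarrow> clock_slice N m (0\<^sub>v (N * m)) t = 0\<^sub>v N"
  by (intro eq_vecI) (auto simp: clock_slice_def mult_add_less)

text \<open>The remainder of an index modulo \<open>m\<close> names its slice, the quotient its
  position in that slice.\<close>

lemma clock_slice_eqI:
  assumes v: "v \<in> carrier_vec (N * m)" and w: "w \<in> carrier_vec (N * m)"
    and slices: "\<And>t. t < m \<Longrightarrow> clock_slice N m v t = clock_slice N m w t"
  shows "v = w"
proof (rule eq_vecI)
  fix k assume "k < dim_vec w"
  then have k: "k < N * m" using w by simp
  then have "k div m < N" "k mod m < m"
    by (auto simp: less_mult_imp_div_less mult.commute) (metis gr0I mod_less_divisor mult_0_right not_less0)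
  then show "v $ k = w $ k"
    using arg_cong[OF slices[of "k mod m"], of "\<lambda>x. x $ (k div m)"] by (simp add: clock_slice_def)
qed (use v w in simp)

text \<open>Different clock values are orthogonal. This reduces quadratic forms on the whole space
  to computations on the register.\<close>

lemma cscalar_prod_clock_slice:
  assumes "v \<in> carrier_vec (N * m)" "w \<in> carrier_vec (N * m)"
  shows "v \<bullet>c w = (\<Sum>t<m. clock_slice N m v t \<bullet>c clock_slice N m w t)"
proof -
  have "v \<bullet>c w = (\<Sum>k<N * m. v $ k * cnj (w $ k))"
    using assms by (simp add: scalar_prod_def lessThan_atLeast0)
  also have "\<dots> = (\<Sum>t<m. \<Sum>i<N. v $ (i * m + t) * cnj (w $ (i * m + t)))"
    by (subst sum.swap) (rule sum_lessThan_mult)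
  finally show ?thesis by (simp add: scalar_prod_def lessThan_atLeast0 clock_slice_def)
qed

section \<open>Kronecker products seen through clock slices\<close>

lemma dim_ketbra [simp]: "dim_row (ketbra d a b) = d" "dim_col (ketbra d a b) = d"
  by (simp_all add: ketbra_def)

lemma kron_ketbra_carrier [simp]: "A \<in> carrier_mat N N \<Longrightarrow> A \<otimes>\<^sub>m ketbra m a b \<in> carrier_mat (N * m) (N * m)"
  by (auto simp: kron_mat_def)

text \<open>Row \<open>i * m + s\<close> vanishes unless \<open>s = a\<close>, and then only the
  columns \<open>j * m + b\<close> matter. The Hamiltonian terms are handled through this rule
  instead of the entries of their clock factors.\<close>

lemma clock_slice_kron_ketbra:
  assumes A: "A \<in> carrier_mat N N" and w: "w \<in> carrier_vec (N * m)" and "s < m" "a < m" "b < m"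
  shows "clock_slice N m ((A \<otimes>\<^sub>m ketbra m a b) *\<^sub>v w) s =
    (if s = a then A *\<^sub>v clock_slice N m w b else 0\<^sub>v N)"
proof (rule eq_vecI)
  fix i assume "i < dim_vec (if s = a then A *\<^sub>v clock_slice N m w b else 0\<^sub>v N)"
  then have i: "i < N" using A by (simp split: if_splits)
  have entry: "(A \<otimes>\<^sub>m ketbra m a b) $$ (i * m + s, j * m + t) = (if s = a \<and> t = b then A $$ (i, j) else 0)"
    if "j < N" "t < m" for j t
    using that i assms mult_add_less[of i N s m] mult_add_less[of j N t m]
    by (auto simp: kron_mat_def ketbra_def)
  have "clock_slice N m ((A \<otimes>\<^sub>m ketbra m a b) *\<^sub>v w) s $ i =
      (\<Sum>k<N * m. (A \<otimes>\<^sub>m ketbra m a b) $$ (i * m + s, k) * w $ k)"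
    using i w assms(3) carrier_matD[OF kron_ketbra_carrier[OF A, of m a b]] mult_add_less[of i N s m]
    by (simp add: clock_slice_def scalar_prod_def lessThan_atLeast0)
  also have "\<dots> = (\<Sum>j<N. \<Sum>t<m. (if t = b then (if s = a then A $$ (i, j) * w $ (j * m + b) else 0) else 0))"
    unfolding sum_lessThan_mult by (intro sum.cong refl) (simp add: entry)
  also have "\<dots> = (\<Sum>j<N. if s = a then A $$ (i, j) * w $ (j * m + b) else 0)"
    using assms by simp
  also have "\<dots> = (if s = a then A *\<^sub>v clock_slice N m w b else 0\<^sub>v N) $ i"
    using i A by (auto simp: clock_slice_def scalar_prod_def lessThan_atLeast0)
  finally show "clock_slice N m ((A \<otimes>\<^sub>m ketbra m a b) *\<^sub>v w) s $ i =
    (if s = a then A *\<^sub>v clock_slice N m w b else 0\<^sub>v N) $ i" .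
qed (use A in simp)

lemma kron_unit_vec_carrier [simp]: "v \<in> carrier_vec N \<Longrightarrow> v \<otimes>\<^sub>v unit_vec m t \<in> carrier_vec (N * m)"
  by (auto simp: kron_vec_def)

lemma clock_slice_kron_unit_vec:
  assumes "v \<in> carrier_vec N" "s < m" "t < m"
  shows "clock_slice N m (v \<otimes>\<^sub>v unit_vec m t) s = (if s = t then v else 0\<^sub>v N)"
  using assms by (intro eq_vecI) (auto simp: clock_slice_def kron_vec_def mult_add_less)

text \<open>Only slice \<open>a\<close> contributes, so form and kernel are those of
  \<open>A\<close> on that slice.\<close>

lemma psd_mat_kron_ketbra:
  assumes A: "psd_mat N A" and a: "a < m"
  shows "psd_mat (N * m) (A \<otimes>\<^sub>m ketbra m a a)"
    and "w \<in> carrier_vec (N * m) \<Longrightarrow>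
      (A \<otimes>\<^sub>m ketbra m a a) *\<^sub>v w = 0\<^sub>v (N * m) \<longleftrightarrow> A *\<^sub>v clock_slice N m w a = 0\<^sub>v N"
proof -
  note carr = psd_matD(1)[OF A]
  note slice = clock_slice_kron_ketbra[OF carr _ _ a a]
  have T: "A \<otimes>\<^sub>m ketbra m a a \<in> carrier_mat (N * m) (N * m)" using carr by simp
  have form: "((A \<otimes>\<^sub>m ketbra m a a) *\<^sub>v w) \<bullet>c w = (A *\<^sub>v clock_slice N m w a) \<bullet>c clock_slice N m w a"
    if w: "w \<in> carrier_vec (N * m)" for w
  proof -
    have "((A \<otimes>\<^sub>m ketbra m a a) *\<^sub>v w) \<bullet>c w =
      (\<Sum>s<m. if s = a then (A *\<^sub>v clock_slice N m w a) \<bullet>c clock_slice N m w a else 0)"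
      using w T
      by (subst cscalar_prod_clock_slice[of _ N m]) (auto simp: slice simp del: sum.delta intro!: sum.cong[OF refl])
    then show ?thesis using a by simp
  qed
  show ker: "(A \<otimes>\<^sub>m ketbra m a a) *\<^sub>v w = 0\<^sub>v (N * m) \<longleftrightarrow> A *\<^sub>v clock_slice N m w a = 0\<^sub>v N"
    if w: "w \<in> carrier_vec (N * m)" for w
  proof
    show "(A \<otimes>\<^sub>m ketbra m a a) *\<^sub>v w = 0\<^sub>v (N * m)" if "A *\<^sub>v clock_slice N m w a = 0\<^sub>v N"
      using w T that by - (rule clock_slice_eqI[of _ N m], auto simp: slice clock_slice_zero)
    show "A *\<^sub>v clock_slice N m w a = 0\<^sub>v N" if "(A \<otimes>\<^sub>m ketbra m a a) *\<^sub>v w = 0\<^sub>v (N * m)"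
      using slice[OF w a] that a by (simp add: clock_slice_zero)
  qed
  show "psd_mat (N * m) (A \<otimes>\<^sub>m ketbra m a a)"
  proof (rule psd_matI)
    fix w :: "complex vec" assume w: "w \<in> carrier_vec (N * m)"
    show "0 \<le> ((A \<otimes>\<^sub>m ketbra m a a) *\<^sub>v w) \<bullet>c w"
      unfolding form[OF w] by (rule psd_matD(2)[OF A]) simp
    show "(A \<otimes>\<^sub>m ketbra m a a) *\<^sub>v w = 0\<^sub>v (N * m)" if "((A \<otimes>\<^sub>m ketbra m a a) *\<^sub>v w) \<bullet>c w = 0"
      using that psd_matD(3)[OF A, of "clock_slice N m w a"] unfolding form[OF w] ker[OF w] by simp
  qed (fact T)
qed

section \<open>Bits of register indices and the input projectors\<close>

lemma kron_mat_carrier: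
  "A \<in> carrier_mat a b \<Longrightarrow> B \<in> carrier_mat c d \<Longrightarrow> A \<otimes>\<^sub>m B \<in> carrier_mat (a * c) (b * d)"
  by (auto simp: kron_mat_def)

text \<open>The bracketing follows the right-associated Kronecker product in
  \<open>P1\<close>.\<close>

lemma two_power_split:
  assumes "i \<in> {1..n}"
  shows "(2::nat) ^ n = 2 ^ (i - 1) * (2 * 2 ^ (n - i))"
proof -
  have "n = (i - 1) + Suc (n - i)" using assms by auto
  then show ?thesis by (metis power_add power_Suc)
qed

lemma P1_carrier:
  assumes "i \<in> {1..n}"
  shows "P1 n i \<in> carrier_mat (2 ^ n) (2 ^ n)"
  unfolding P1_def two_power_split[OF assms]
  by (intro kron_mat_carrier one_carrier_mat carrier_matI dim_ketbra)

text \<open>Qubit 1 is the leftmost factor, hence the most significant bit, so qubit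
  \<open>i\<close> is bit \<open>n - i\<close> of the index. With \<open>m = 2 ^ (n - i)\<close> an
  index \<open>c\<close> has the coordinates \<open>c div (2 * m)\<close>,
  \<open>c div m mod 2\<close> and \<open>c mod m\<close>; the identity factors force the outer ones
  to agree, the projector forces the middle one to be 1.\<close>

lemma P1_index:
  assumes i: "i \<in> {1..n}" and a: "a < 2 ^ n" and b: "b < 2 ^ n"
  shows "P1 n i $$ (a, b) = (if a = b \<and> bit a (n - i) then 1 else 0)"
proof -
  define m :: nat where "m = 2 ^ (n - i)"
  have m: "m > 0" by (simp add: m_def)
  have n: "(2::nat) ^ n = 2 ^ (i - 1) * (2 * m)"
    unfolding m_def using i by (rule two_power_split)
  \<comment> \<open>The inner Kronecker product is indexed by \<open>c mod (2 * m)\<close>; these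
    equations bring its coordinates and the outer one into terms of \<open>c div m\<close> and
    \<open>c mod m\<close>.\<close>
  have dm: "c mod (2 * m) div m = c div m mod 2" "c mod (2 * m) mod m = c mod m"
    "c div (2 * m) = c div m div 2" for c
    using m by (simp_all add: mod_mult2_eq[of c m 2] mult.commute div_mult2_eq)
  have lt: "c div (2 * m) < 2 ^ (i - 1)" if "c < 2 ^ n" for c
    using that unfolding n by (simp add: less_mult_imp_div_less)
  have eq: "a = b" if "a div m div 2 = b div m div 2" "a div m mod 2 = b div m mod 2" "a mod m = b mod m"
    using that by (metis div_mult_mod_eq)
  show ?thesis
    using a b lt[OF a] lt[OF b] eq m
    unfolding P1_def m_def[symmetric] bit_iff_odd
    by (auto simp: kron_mat_def ketbra_def n dm odd_iff_mod_2_eq_one mod_less_divisor)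
qed

lemma P1_mult_vec_index:
  assumes "i \<in> {1..n}" "x \<in> carrier_vec (2 ^ n)" "a < 2 ^ n"
  shows "(P1 n i *\<^sub>v x) $ a = (if bit a (n - i) then x $ a else 0)"
proof -
  have "(P1 n i *\<^sub>v x) $ a = (\<Sum>b<2 ^ n. if b = a then (if bit a (n - i) then x $ a else 0) else 0)"
    using assms P1_carrier[of i n]
    by (auto simp: scalar_prod_def lessThan_atLeast0 P1_index simp del: sum.delta intro!: sum.cong[OF refl])
  then show ?thesis using assms by simp
qed

lemma psd_mat_P1:
  assumes i: "i \<in> {1..n}"
  shows "psd_mat (2 ^ n) (P1 n i)"
proof (rule psd_matI)
  show P: "P1 n i \<in> carrier_mat (2 ^ n) (2 ^ n)" using i by (rule P1_carrier)
  fix w :: "complex vec" assume w: "w \<in> carrier_vec (2 ^ n)"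
  \<comment> \<open>A diagonal 0-1 matrix is an orthogonal projector: each entry of the image is
    \<open>w $ a\<close> or 0, so putting the image for the second \<open>w\<close> changes no
    summand.\<close>
  have "(P1 n i *\<^sub>v w) \<bullet>c w = (P1 n i *\<^sub>v w) \<bullet>c (P1 n i *\<^sub>v w)"
    using w P i by (auto simp: scalar_prod_def P1_mult_vec_index simp del: index_mult_mat_vec intro!: sum.cong)
  then show "0 \<le> (P1 n i *\<^sub>v w) \<bullet>c w" "(P1 n i *\<^sub>v w) \<bullet>c w = 0 \<Longrightarrow> P1 n i *\<^sub>v w = 0\<^sub>v (2 ^ n)"
    using P w by (auto simp: conjugate_square_eq_0_vec[of _ "2 ^ n"])
qed

lemma nonzero_nat_obtains_bit:
  fixes a :: nat
  assumes "a \<noteq> 0" "a < 2 ^ n"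
  obtains k where "k < n" "bit a k"
proof -
  obtain k where k: "bit a k" using assms(1) by (metis bit_eq_iff bit_0_eq bot_apply bot_bool_def)
  have "k < n"
  proof (rule ccontr)
    assume "\<not> k < n"
    then have "a < 2 ^ k" using assms(2) power_increasing[of n k "2::nat"] by linarith
    then show False using k by (simp add: bit_iff_odd)
  qed
  then show ?thesis using k that by blast
qed

text \<open>Every nonzero index has a set bit, and the projector of the corresponding qubit forces
  that entry to vanish; index 0 has no set bit and is never touched.\<close>

lemma P1_kernel:
  assumes x: "x \<in> carrier_vec (2 ^ n)"
  shows "(\<forall>i\<in>{1..n}. P1 n i *\<^sub>v x = 0\<^sub>v (2 ^ n)) \<longleftrightarrow> x = x $ 0 \<cdot>\<^sub>v unit_vec (2 ^ n) 0"
proof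
  assume ker: "\<forall>i\<in>{1..n}. P1 n i *\<^sub>v x = 0\<^sub>v (2 ^ n)"
  have "x $ a = 0" if a: "a \<noteq> 0" "a < 2 ^ n" for a
  proof -
    obtain k where k: "k < n" "bit a k" using a by (rule nonzero_nat_obtains_bit)
    \<comment> \<open>Bit \<open>k\<close> belongs to qubit \<open>n - k\<close>.\<close>
    then have i: "n - k \<in> {1..n}" by auto
    have "(P1 n (n - k) *\<^sub>v x) $ a = 0" using ker i a by simp
    then show ?thesis using P1_mult_vec_index[OF i x a(2)] k by simp
  qed
  then show "x = x $ 0 \<cdot>\<^sub>v unit_vec (2 ^ n) 0" using x by (intro eq_vecI) auto
next
  assume eq: "x = x $ 0 \<cdot>\<^sub>v unit_vec (2 ^ n) 0"
  have z: "x $ a = 0" if "a \<noteq> 0" "a < 2 ^ n" for a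
    using arg_cong[OF eq, of "\<lambda>v. v $ a"] that by simp
  show "\<forall>i\<in>{1..n}. P1 n i *\<^sub>v x = 0\<^sub>v (2 ^ n)"
  proof
    fix i assume i: "i \<in> {1..n}"
    show "P1 n i *\<^sub>v x = 0\<^sub>v (2 ^ n)"
    proof (rule eq_vecI)
      fix a assume "a < dim_vec (0\<^sub>v (2 ^ n) :: complex vec)"
      then have "a < 2 ^ n" by simp
      then show "(P1 n i *\<^sub>v x) $ a = 0\<^sub>v (2 ^ n) $ a"
        using P1_mult_vec_index[OF i x, of a] z[of a] by (cases "a = 0") auto
    qed (use P1_carrier[OF i] in simp)
  qed
qed

lemma tensor_power_unit_vec_0: "tensor_power_vec (unit_vec 2 0) n = unit_vec (2 ^ n) 0"
proof (induction n)
  case (Suc n)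
  show ?case
  proof (rule eq_vecI)
    fix k :: nat assume "k < dim_vec (unit_vec (2 ^ Suc n) 0 :: complex vec)"
    then have k: "k < 2 * 2 ^ n" by simp
    have "k = 0 \<longleftrightarrow> k div 2 ^ n = 0 \<and> k mod 2 ^ n = 0" by (metis div_0 div_mult_mod_eq mod_0 mult_0 add_0)
    moreover have "k div 2 ^ n < 2" using k by (simp add: less_mult_imp_div_less)
    ultimately show "tensor_power_vec (unit_vec 2 0) (Suc n) $ k = (unit_vec (2 ^ Suc n) 0 :: complex vec) $ k"
      using k by (auto simp: kron_vec_def Suc.IH)
  qed (simp add: kron_vec_def Suc.IH)
qed simp

section \<open>Unitaries and their products preserve inner products\<close>

lemma U_prod_carrier:
  assumes "\<And>t. t \<in> {1..L} \<Longrightarrow> unitary_mat (2 ^ n) (U t)" "t \<le> L"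
  shows "U_prod n U t \<in> carrier_mat (2 ^ n) (2 ^ n)"
  using assms(2)
proof (induction t)
  case (Suc t)
  then show ?case using assms(1)[of "Suc t"] by (auto simp: unitary_mat_def)
qed simp

lemma unitary_mat_cscalar_prod:
  assumes U: "unitary_mat d U" and x: "x \<in> carrier_vec d" and y: "y \<in> carrier_vec d"
  shows "(U *\<^sub>v x) \<bullet>c (U *\<^sub>v y) = x \<bullet>c y"
proof -
  have U': "U \<in> carrier_mat d d" "mat_adjoint U \<in> carrier_mat d d" "mat_adjoint U * U = 1\<^sub>m d"
    using U mat_adjoint_carrier by (auto simp: unitary_mat_def)
  have "(U *\<^sub>v x) \<bullet>c (U *\<^sub>v y) = x \<bullet>c (mat_adjoint U *\<^sub>v (U *\<^sub>v y))"
    using U' x y by (intro cscalar_prod_mult_mat_vec_left) auto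
  also have "mat_adjoint U *\<^sub>v (U *\<^sub>v y) = y"
    using U' y by (simp flip: assoc_mult_mat_vec[of _ d d])
  finally show ?thesis .
qed

lemma U_prod_cscalar_prod:
  assumes U: "\<And>t. t \<in> {1..L} \<Longrightarrow> unitary_mat (2 ^ n) (U t)" and "t \<le> L"
    and x: "x \<in> carrier_vec (2 ^ n)" "y \<in> carrier_vec (2 ^ n)"
  shows "(U_prod n U t *\<^sub>v x) \<bullet>c (U_prod n U t *\<^sub>v y) = x \<bullet>c y"
  using assms(2)
proof (induction t)
  case (Suc t)
  have Us: "unitary_mat (2 ^ n) (U (Suc t))" using U Suc.prems by simp
  then have "U (Suc t) \<in> carrier_mat (2 ^ n) (2 ^ n)" by (simp add: unitary_mat_def)
  then show ?case
    using Suc U_prod_carrier[of L n U t, OF U] x unitary_mat_cscalar_prod[OF Us]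
    by (simp add: assoc_mult_mat_vec[of _ "2 ^ n" "2 ^ n" _ "2 ^ n"])
qed (use x in simp)

section \<open>The propagation Hamiltonian and its kernel\<close>

context
  fixes n L :: nat and U :: "nat \<Rightarrow> complex mat"
  assumes U: "\<And>t. t \<in> {1..L} \<Longrightarrow> unitary_mat (2 ^ n) (U t)"
begin

lemma U_carrier:
  assumes "t \<in> {1..L}"
  shows "U t \<in> carrier_mat (2 ^ n) (2 ^ n)" "mat_adjoint (U t) \<in> carrier_mat (2 ^ n) (2 ^ n)"
    "mat_adjoint (U t) * U t = 1\<^sub>m (2 ^ n)"
  using U[OF assms] mat_adjoint_carrier by (auto simp: unitary_mat_def)

lemma H_step_carrier:
  assumes "t \<in> {1..L}"
  shows "H_step n L U t \<in> carrier_mat (2 ^ n * (L + 1)) (2 ^ n * (L + 1))"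
  unfolding H_step_def using U_carrier[OF assms]
  by (intro smult_carrier_mat add_carrier_mat kron_ketbra_carrier) auto

text \<open>Of the four Kronecker terms two write into slice \<open>t\<close> and two into slice
  \<open>t - 1\<close>.\<close>

lemma clock_slice_H_step:
  assumes t: "t \<in> {1..L}" and s: "s < L + 1" and w: "w \<in> carrier_vec (2 ^ n * (L + 1))"
  defines "w' \<equiv> clock_slice (2 ^ n) (L + 1) w"
  shows "clock_slice (2 ^ n) (L + 1) (H_step n L U t *\<^sub>v w) s =
    (if s = t then (1 / 2) \<cdot>\<^sub>v (w' t - U t *\<^sub>v w' (t - 1))
     else if s = t - 1 then (1 / 2) \<cdot>\<^sub>v (w' (t - 1) - mat_adjoint (U t) *\<^sub>v w' t)
     else 0\<^sub>v (2 ^ n))"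
proof -
  define N :: nat where "N = 2 ^ n"
  define m where "m = L + 1"
  note Uc = U_carrier(1,2)[OF t, folded N_def]
  \<comment> \<open>Subtraction on naturals is truncated, so \<open>t - 1 \<noteq> t\<close> relies
    on \<open>t \<ge> 1\<close>.\<close>
  have tm: "t < m" "t - 1 < m" "t - 1 \<noteq> t" "s < m" using t s by (auto simp: m_def)
  note w = w[folded N_def m_def]
  let ?A = "U t \<otimes>\<^sub>m ketbra m t (t - 1)" and ?B = "mat_adjoint (U t) \<otimes>\<^sub>m ketbra m (t - 1) t"
    and ?C = "1\<^sub>m N \<otimes>\<^sub>m ketbra m t t" and ?D = "1\<^sub>m N \<otimes>\<^sub>m ketbra m (t - 1) (t - 1)"
  have c: "?A \<in> carrier_mat (N * m) (N * m)" "?B \<in> carrier_mat (N * m) (N * m)"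
    "?C \<in> carrier_mat (N * m) (N * m)" "?D \<in> carrier_mat (N * m) (N * m)"
    using Uc by auto
  have cw: "?A *\<^sub>v w \<in> carrier_vec (N * m)" "?B *\<^sub>v w \<in> carrier_vec (N * m)"
    "?C *\<^sub>v w \<in> carrier_vec (N * m)" "?D *\<^sub>v w \<in> carrier_vec (N * m)"
    using c by (auto intro!: mult_mat_vec_carrier[OF _ w])
  have "H_step n L U t *\<^sub>v w =
      (1 / 2) \<cdot>\<^sub>v (- (?A *\<^sub>v w) - ?B *\<^sub>v w + ?C *\<^sub>v w + ?D *\<^sub>v w)"
    unfolding H_step_def N_def[symmetric] m_def[symmetric]
    using c w
    by (simp add: minus_carrier_mat smult_mult_mat_vec[of _ "N * m" "N * m"] add_mult_distrib_mat_vec[of _ "N * m" "N * m"]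
        minus_mult_distrib_mat_vec[of _ "N * m" "N * m"])
  then have "clock_slice N m (H_step n L U t *\<^sub>v w) s = (1 / 2) \<cdot>\<^sub>v
      (- clock_slice N m (?A *\<^sub>v w) s - clock_slice N m (?B *\<^sub>v w) s
        + clock_slice N m (?C *\<^sub>v w) s + clock_slice N m (?D *\<^sub>v w) s)"
    using cw tm by (simp add: clock_slice_smult clock_slice_add clock_slice_minus clock_slice_uminus)
  also have "\<dots> = (if s = t then (1 / 2) \<cdot>\<^sub>v (w' t - U t *\<^sub>v w' (t - 1))
     else if s = t - 1 then (1 / 2) \<cdot>\<^sub>v (w' (t - 1) - mat_adjoint (U t) *\<^sub>v w' t)
     else 0\<^sub>v N)"
    using tm Uc w unfolding w'_def N_def[symmetric] m_def[symmetric]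
    by (intro eq_vecI)
      (auto simp: clock_slice_kron_ketbra[of "U t" N] clock_slice_kron_ketbra[of "mat_adjoint (U t)" N]
        clock_slice_kron_ketbra[of "1\<^sub>m N" N] simp del: index_mult_mat_vec)
  finally show ?thesis unfolding N_def m_def .
qed

text \<open>Unitarity gives \<open>w\<^bsub>t-1\<^esub> - U\<^sub>t\<^sup>\<dagger> w\<^sub>t = - U\<^sub>t\<^sup>\<dagger> e\<close>, which turns the form into a square.\<close>

lemma H_step_form:
  assumes t: "t \<in> {1..L}" and w: "w \<in> carrier_vec (2 ^ n * (L + 1))"
  defines "e \<equiv> clock_slice (2 ^ n) (L + 1) w t - U t *\<^sub>v clock_slice (2 ^ n) (L + 1) w (t - 1)"
  shows "(H_step n L U t *\<^sub>v w) \<bullet>c w = 1 / 2 * (e \<bullet>c e)"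
proof -
  define N :: nat where "N = 2 ^ n"
  define m where "m = L + 1"
  note w = w[folded N_def m_def]
  note Uc = U_carrier[OF t, folded N_def]
  define x where "x = clock_slice N m w t"
  define y where "y = clock_slice N m w (t - 1)"
  define z where "z = y - mat_adjoint (U t) *\<^sub>v x"
  have xy: "x \<in> carrier_vec N" "y \<in> carrier_vec N" by (simp_all add: x_def y_def)
  have e: "e = x - U t *\<^sub>v y" by (simp add: e_def x_def y_def N_def m_def)
  have ec: "e \<in> carrier_vec N" "z \<in> carrier_vec N" using xy Uc by (auto simp: e z_def)
  have "mat_adjoint (U t) *\<^sub>v (U t *\<^sub>v y) = y"
    using Uc xy by (simp flip: assoc_mult_mat_vec[of _ N N])
  then have z: "z = - (mat_adjoint (U t) *\<^sub>v e)"
    using Uc xy mult_minus_distrib_mat_vec[of "mat_adjoint (U t)" N N x "U t *\<^sub>v y"]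
    by (auto simp: z_def e)
  have tm: "t < m" "t - 1 < m" "t - 1 \<noteq> t" using t by (auto simp: m_def)
  have Hc: "H_step n L U t *\<^sub>v w \<in> carrier_vec (N * m)"
    using H_step_carrier[OF t] w by (simp add: N_def m_def)
  \<comment> \<open>Two separate indicator terms, one for each affected slice, let the sum over
    clock values collapse.\<close>
  have "(H_step n L U t *\<^sub>v w) \<bullet>c w = (\<Sum>s<m. (if s = t then 1 / 2 * (e \<bullet>c x) else 0)
      + (if s = t - 1 then 1 / 2 * (z \<bullet>c y) else 0))"
    unfolding cscalar_prod_clock_slice[OF Hc w]
  proof (rule sum.cong[OF refl])
    fix s assume "s \<in> {..<m}"
    then have s: "s < L + 1" by (simp add: m_def)
    show "clock_slice N m (H_step n L U t *\<^sub>v w) s \<bullet>c clock_slice N m w s =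
      (if s = t then 1 / 2 * (e \<bullet>c x) else 0) + (if s = t - 1 then 1 / 2 * (z \<bullet>c y) else 0)"
      using clock_slice_H_step[OF t s w[unfolded N_def m_def], folded N_def m_def, folded x_def y_def]
        tm ec xy by (auto simp: e[symmetric] z_def[symmetric] x_def[symmetric] y_def[symmetric, unfolded One_nat_def])
  qed
  also have "\<dots> = 1 / 2 * (e \<bullet>c x + z \<bullet>c y)"
    using tm by (simp add: sum.distrib field_simps)
  also have "z \<bullet>c y = - ((mat_adjoint (U t) *\<^sub>v e) \<bullet>c y)"
    using Uc xy ec by (simp add: z)
  \<comment> \<open>The adjoint rule relates a matrix on the left to its adjoint on the right,
    whereas here the adjoint stands on the left; hence the detour through conjugate
    symmetry.\<close>
  also have "(mat_adjoint (U t) *\<^sub>v e) \<bullet>c y = cnj (y \<bullet>c (mat_adjoint (U t) *\<^sub>v e))"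
    using Uc xy ec
      conjugate_conjugate_sprod[of "mat_adjoint (U t) *\<^sub>v e" N y]
      conjugate_vec_sprod_comm[of y N "mat_adjoint (U t) *\<^sub>v e"] by simp
  also have "y \<bullet>c (mat_adjoint (U t) *\<^sub>v e) = (U t *\<^sub>v y) \<bullet>c e"
    using Uc xy ec by (intro cscalar_prod_mult_mat_vec_left[symmetric])
  also have "cnj ((U t *\<^sub>v y) \<bullet>c e) = e \<bullet>c (U t *\<^sub>v y)"
    using Uc xy ec conjugate_conjugate_sprod[of e N "U t *\<^sub>v y"]
      conjugate_vec_sprod_comm[of "U t *\<^sub>v y" N e] by simp
  also have "e \<bullet>c x + - (e \<bullet>c (U t *\<^sub>v y)) = e \<bullet>c e"
  proof -
    have "conjugate e = conjugate x - conjugate (U t *\<^sub>v y)"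
      using xy Uc unfolding e by (intro eq_vecI) (auto simp del: index_mult_mat_vec)
    then show ?thesis using ec xy Uc by (simp add: scalar_prod_minus_distrib[of _ N])
  qed
  finally show ?thesis .
qed

lemma psd_mat_H_step:
  assumes t: "t \<in> {1..L}"
  shows "psd_mat (2 ^ n * (L + 1)) (H_step n L U t)"
    and "w \<in> carrier_vec (2 ^ n * (L + 1)) \<Longrightarrow> H_step n L U t *\<^sub>v w = 0\<^sub>v (2 ^ n * (L + 1)) \<longleftrightarrow>
      clock_slice (2 ^ n) (L + 1) w t = U t *\<^sub>v clock_slice (2 ^ n) (L + 1) w (t - 1)"
proof -
  define N :: nat where "N = 2 ^ n"
  define m where "m = L + 1"
  define e where "e w = clock_slice N m w t - U t *\<^sub>v clock_slice N m w (t - 1)" for w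
  note Uc = U_carrier[OF t, folded N_def]
  note form = H_step_form[OF t, folded N_def m_def, folded e_def]
  note Hc = H_step_carrier[OF t, folded N_def m_def]
  have tm: "t < m" "t - 1 < m" "t - 1 \<noteq> t" using t by (auto simp: m_def)
  have ec: "e w \<in> carrier_vec N" for w using Uc by (simp add: e_def)
  have e0: "e w = 0\<^sub>v N \<longleftrightarrow> clock_slice N m w t = U t *\<^sub>v clock_slice N m w (t - 1)" for w
    using Uc by (auto simp: e_def vec_eq_iff)
  have ker: "H_step n L U t *\<^sub>v w = 0\<^sub>v (N * m) \<longleftrightarrow> e w = 0\<^sub>v N" if w: "w \<in> carrier_vec (N * m)" for w
  proof
    assume "H_step n L U t *\<^sub>v w = 0\<^sub>v (N * m)"
    then have "e w \<bullet>c e w = 0" using form[OF w] w by simp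
    then show "e w = 0\<^sub>v N" using conjugate_square_eq_0_vec[OF ec[of w]] by blast
  next
    assume "e w = 0\<^sub>v N"
    then have x: "clock_slice N m w t = U t *\<^sub>v clock_slice N m w (t - 1)" by (simp add: e0)
    \<comment> \<open>By unitarity the relation can be inverted, so the slice of the image at
      \<open>t - 1\<close> vanishes as well as the one at \<open>t\<close>.\<close>
    have y: "mat_adjoint (U t) *\<^sub>v clock_slice N m w t = clock_slice N m w (t - 1)"
      unfolding x using Uc by (simp flip: assoc_mult_mat_vec[of _ N N])
    have cancel: "(1 / 2) \<cdot>\<^sub>v (v - v) = 0\<^sub>v N" if "v \<in> carrier_vec N" for v :: "complex vec"
      using that by (intro eq_vecI) auto
    show "H_step n L U t *\<^sub>v w = 0\<^sub>v (N * m)"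
    proof (rule clock_slice_eqI[of _ N m])
      fix s assume s: "s < m"
      show "clock_slice N m (H_step n L U t *\<^sub>v w) s = clock_slice N m (0\<^sub>v (N * m)) s"
        using clock_slice_H_step[OF t s[unfolded m_def] w[unfolded N_def m_def], folded N_def m_def]
        unfolding y x[symmetric] clock_slice_zero[OF s] by (simp only: cancel clock_slice_carrier if_cancel)
    qed (use Hc w in auto)
  qed
  show "H_step n L U t *\<^sub>v w = 0\<^sub>v (2 ^ n * (L + 1)) \<longleftrightarrow>
      clock_slice (2 ^ n) (L + 1) w t = U t *\<^sub>v clock_slice (2 ^ n) (L + 1) w (t - 1)"
    if "w \<in> carrier_vec (2 ^ n * (L + 1))"
    using ker e0 that by (simp add: N_def m_def)
  have "psd_mat (N * m) (H_step n L U t)"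
  proof (rule psd_matI)
    fix w :: "complex vec" assume w: "w \<in> carrier_vec (N * m)"
    show "0 \<le> (H_step n L U t *\<^sub>v w) \<bullet>c w"
      unfolding form[OF w] by (intro mult_nonneg_nonneg conjugate_square_ge_0_vec) (simp add: less_eq_complex_def)
    show "H_step n L U t *\<^sub>v w = 0\<^sub>v (N * m)" if "(H_step n L U t *\<^sub>v w) \<bullet>c w = 0"
      using that conjugate_square_eq_0_vec[OF ec[of w]] unfolding form[OF w] ker[OF w] by simp
  qed (fact Hc)
  then show "psd_mat (2 ^ n * (L + 1)) (H_step n L U t)" by (simp add: N_def m_def)
qed

lemma psd_mat_H_prop: "psd_mat (2 ^ n * (L + 1)) (H_prop n L U)"
  unfolding H_prop_def by (rule psd_mat_msum(1)[OF finite_atLeastAtMost psd_mat_H_step(1)])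

lemma H_prop_kernel_step:
  assumes w: "w \<in> carrier_vec (2 ^ n * (L + 1))"
  shows "H_prop n L U *\<^sub>v w = 0\<^sub>v (2 ^ n * (L + 1)) \<longleftrightarrow>
    (\<forall>t\<in>{1..L}. clock_slice (2 ^ n) (L + 1) w t = U t *\<^sub>v clock_slice (2 ^ n) (L + 1) w (t - 1))"
  unfolding H_prop_def
  using psd_mat_H_step(1) psd_mat_H_step(2)[OF _ w]
  by (subst psd_mat_msum(2)[OF _ _ w]) auto

text \<open>The local relations between neighbouring slices are chained by induction on the clock
  value.\<close>

lemma H_prop_kernel:
  assumes w: "w \<in> carrier_vec (2 ^ n * (L + 1))"
  shows "H_prop n L U *\<^sub>v w = 0\<^sub>v (2 ^ n * (L + 1)) \<longleftrightarrow>
    (\<forall>t\<le>L. clock_slice (2 ^ n) (L + 1) w t = U_prod n U t *\<^sub>v clock_slice (2 ^ n) (L + 1) w 0)"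
    (is "?ker \<longleftrightarrow> (\<forall>t\<le>L. ?w t = _)")
proof
  have step: "U_prod n U (Suc t) *\<^sub>v ?w 0 = U (Suc t) *\<^sub>v (U_prod n U t *\<^sub>v ?w 0)" if "Suc t \<le> L" for t
    using U_carrier(1)[of "Suc t"] U_prod_carrier[of L n U t, OF U] that
    by (simp add: assoc_mult_mat_vec[of _ "2 ^ n" "2 ^ n" _ "2 ^ n"])
  show "\<forall>t\<le>L. ?w t = U_prod n U t *\<^sub>v ?w 0" if ?ker
  proof (intro allI impI)
    fix t assume "t \<le> L"
    then show "?w t = U_prod n U t *\<^sub>v ?w 0"
    proof (induction t)
      case (Suc t)
      have "?w (Suc t) = U (Suc t) *\<^sub>v ?w t"
        using that Suc.prems unfolding H_prop_kernel_step[OF w] by force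
      then show ?case using Suc step by simp
    qed simp
  qed
  show ?ker if h: "\<forall>t\<le>L. ?w t = U_prod n U t *\<^sub>v ?w 0"
    unfolding H_prop_kernel_step[OF w]
  proof
    fix t assume t: "t \<in> {1..L}"
    then obtain t' where t': "t = Suc t'" by (cases t) auto
    then have "Suc t' \<le> L" using t by simp
    then have "?w t = U_prod n U (Suc t') *\<^sub>v ?w 0" unfolding t' by (rule h[rule_format])
    also have "\<dots> = U t *\<^sub>v (U_prod n U t' *\<^sub>v ?w 0)" using step[of t'] t unfolding t' by simp
    also have "U_prod n U t' *\<^sub>v ?w 0 = ?w (t - 1)" using h[rule_format, of t'] t t' by simp
    finally show "?w t = U t *\<^sub>v ?w (t - 1)" .
  qed
qed

section \<open>History states and the degeneracy of the propagation Hamiltonian\<close>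

lemma history_state_carrier_slice:
  assumes x: "x \<in> carrier_vec (2 ^ n)"
  shows "history_state n L U x \<in> carrier_vec (2 ^ n * (L + 1))"
    and "s \<le> L \<Longrightarrow> clock_slice (2 ^ n) (L + 1) (history_state n L U x) s =
      complex_of_real (1 / sqrt (real (L + 1))) \<cdot>\<^sub>v (U_prod n U s *\<^sub>v x)"
proof -
  define N :: nat where "N = 2 ^ n"
  define m where "m = L + 1"
  interpret vec_space "TYPE(complex)" "N * m" .
  let ?f = "\<lambda>t. (U_prod n U t *\<^sub>v x) \<otimes>\<^sub>v unit_vec m t"
  have Ux: "U_prod n U t *\<^sub>v x \<in> carrier_vec N" if "t \<le> L" for t
    using U_prod_carrier[of L n U t, OF U] that x by (simp add: N_def)
  have f: "?f t \<in> carrier_vec (N * m)" if "t \<le> L" for t using Ux that by simp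
  have lt: "s < m \<longleftrightarrow> s \<le> L" for s by (auto simp: m_def)
  \<comment> \<open>Partial sums up to \<open>T\<close> have zero slices beyond \<open>T\<close>,
    which lets the induction add one clock value at a time.\<close>
  have *: "vsum (N * m) ?f {0..T} \<in> carrier_vec (N * m) \<and>
    (\<forall>s\<le>L. clock_slice N m (vsum (N * m) ?f {0..T}) s = (if s \<le> T then U_prod n U s *\<^sub>v x else 0\<^sub>v N))"
    if "T \<le> L" for T
    using that
  proof (induction T)
    case 0
    have "vsum (N * m) ?f {0..0} = ?f 0"
      using f[of 0] by (simp add: M.finsum_insert module_vec_simps)
    then show ?case using f[of 0] Ux[of 0]
      by (simp add: clock_slice_kron_unit_vec lt del: U_prod.simps)
  next
    case (Suc T)
    have c: "vsum (N * m) ?f {0..T} \<in> carrier_vec (N * m)" using Suc by simp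
    have "vsum (N * m) ?f {0..Suc T} = ?f (Suc T) + vsum (N * m) ?f {0..T}"
      using f Suc.prems
      by (simp add: atLeastAtMostSuc_conv M.finsum_insert module_vec_simps Pi_def
          del: U_prod.simps)
    then show ?case using f[of "Suc T"] Ux Suc c
      by (auto simp: clock_slice_add clock_slice_kron_unit_vec lt le_Suc_eq simp del: U_prod.simps)
  qed
  show "history_state n L U x \<in> carrier_vec (2 ^ n * (L + 1))"
    using *[of L] by (simp add: history_state_def N_def m_def)
  show "clock_slice (2 ^ n) (L + 1) (history_state n L U x) s =
      complex_of_real (1 / sqrt (real (L + 1))) \<cdot>\<^sub>v (U_prod n U s *\<^sub>v x)" if "s \<le> L"
    using *[of L] that unfolding history_state_def N_def[symmetric] m_def[symmetric]
    by (subst clock_slice_smult) (auto simp: lt)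
qed

text \<open>Each of the \<open>L + 1\<close> slices contributes the same share
  \<open>x \<bullet>c x\<close> divided by \<open>L + 1\<close>, because \<open>U_prod\<close>
  preserves inner products.\<close>

lemma history_state_norm:
  assumes x: "x \<in> carrier_vec (2 ^ n)"
  shows "history_state n L U x \<bullet>c history_state n L U x = x \<bullet>c x"
proof -
  define c where "c = complex_of_real (1 / sqrt (real (L + 1)))"
  have cc: "c * cnj c = 1 / of_nat (L + 1)"
    by (simp add: c_def flip: of_real_mult)
  have "history_state n L U x \<bullet>c history_state n L U x = (\<Sum>s<L + 1. c * cnj c * (x \<bullet>c x))"
    unfolding cscalar_prod_clock_slice[OF history_state_carrier_slice(1)[OF x] history_state_carrier_slice(1)[OF x]]
  proof (rule sum.cong[OF refl])
    fix s assume "s \<in> {..<L + 1}"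
    then have s: "s \<le> L" by simp
    have Ux: "U_prod n U s *\<^sub>v x \<in> carrier_vec (2 ^ n)"
      using U_prod_carrier[of L n U s, OF U] s x by simp
    show "clock_slice (2 ^ n) (L + 1) (history_state n L U x) s \<bullet>c
        clock_slice (2 ^ n) (L + 1) (history_state n L U x) s = c * cnj c * (x \<bullet>c x)"
      unfolding history_state_carrier_slice(2)[OF x s] c_def[symmetric]
      using Ux U_prod_cscalar_prod[OF U s x x] by (simp add: conjugate_smult_vec)
  qed
  also have "\<dots> = x \<bullet>c x" unfolding cc by (simp del: of_nat_Suc)
  finally show ?thesis .
qed

lemma history_state_0_slice:
  assumes x: "x \<in> carrier_vec (2 ^ n)"
  shows "clock_slice (2 ^ n) (L + 1) (history_state n L U x) 0 =
    complex_of_real (1 / sqrt (real (L + 1))) \<cdot>\<^sub>v x"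
  using history_state_carrier_slice(2)[OF x, of 0] x by simp

lemma H_prop_history_state:
  assumes x: "x \<in> carrier_vec (2 ^ n)"
  shows "H_prop n L U *\<^sub>v history_state n L U x = 0\<^sub>v (2 ^ n * (L + 1))"
  unfolding H_prop_kernel[OF history_state_carrier_slice(1)[OF x]] history_state_0_slice[OF x]
proof (intro allI impI)
  fix t assume t: "t \<le> L"
  have Uc: "U_prod n U t \<in> carrier_mat (2 ^ n) (2 ^ n)" using U_prod_carrier[of L n U t, OF U t] .
  show "clock_slice (2 ^ n) (L + 1) (history_state n L U x) t =
    U_prod n U t *\<^sub>v (complex_of_real (1 / sqrt (real (L + 1))) \<cdot>\<^sub>v x)"
    unfolding history_state_carrier_slice(2)[OF x t] mult_mat_vec[OF Uc x] ..
qed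

text \<open>A kernel vector is determined by its slice 0; the factor
  \<open>sqrt (real (L + 1))\<close> undoes the normalisation of the history state.\<close>

lemma H_prop_kernel_eq_history_state:
  assumes w: "w \<in> carrier_vec (2 ^ n * (L + 1))" and x: "x \<in> carrier_vec (2 ^ n)"
    and ker: "H_prop n L U *\<^sub>v w = 0\<^sub>v (2 ^ n * (L + 1))"
    and w0: "clock_slice (2 ^ n) (L + 1) w 0 = c \<cdot>\<^sub>v x"
  shows "w = (c * complex_of_real (sqrt (real (L + 1)))) \<cdot>\<^sub>v history_state n L U x"
proof (rule clock_slice_eqI[OF w])
  note h = history_state_carrier_slice[OF x]
  show "(c * complex_of_real (sqrt (real (L + 1)))) \<cdot>\<^sub>v history_state n L U x \<in> carrier_vec (2 ^ n * (L + 1))"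
    using h by simp
  fix t assume t: "t < L + 1"
  then have tL: "t \<le> L" by simp
  have Uc: "U_prod n U t \<in> carrier_mat (2 ^ n) (2 ^ n)" using U_prod_carrier[of L n U t, OF U] tL by simp
  have "clock_slice (2 ^ n) (L + 1) w t = c \<cdot>\<^sub>v (U_prod n U t *\<^sub>v x)"
    using ker tL mult_mat_vec[OF Uc x] unfolding H_prop_kernel[OF w] w0 by simp
  also have "\<dots> = clock_slice (2 ^ n) (L + 1)
      ((c * complex_of_real (sqrt (real (L + 1)))) \<cdot>\<^sub>v history_state n L U x) t"
    unfolding clock_slice_smult[OF h(1) t] h(2)[OF tL] smult_smult_assoc
    by (simp del: of_nat_Suc flip: of_real_mult)
  finally show "clock_slice (2 ^ n) (L + 1) w t = clock_slice (2 ^ n) (L + 1)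
      ((c * complex_of_real (sqrt (real (L + 1)))) \<cdot>\<^sub>v history_state n L U x) t" .
qed

text \<open>Independent inputs give independent history states, and \<open>n \<ge> 1\<close>
  supplies the two basis inputs with index 0 and 1.\<close>

lemma degenerate_H_prop:
  assumes n: "n \<ge> 1"
  shows "degenerate_ground_space (H_prop n L U)"
proof -
  let ?d = "2 ^ n * (L + 1)"
  let ?e = "unit_vec (2 ^ n) :: nat \<Rightarrow> complex vec"
  let ?h = "\<lambda>i. history_state n L U (?e i)"
  have e: "?e i \<in> carrier_vec (2 ^ n)" for i by simp
  note H = psd_matD(1)[OF psd_mat_H_prop]
  note h = history_state_carrier_slice(1)[OF e] H_prop_history_state[OF e]
  have clock_pos: "0 < L + 1" by simp
  have one_less: "(1::nat) < 2 ^ n" using n by (intro one_less_power) auto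
  have indep: "a = 0 \<and> b = 0" if "a \<cdot>\<^sub>v ?h 0 + b \<cdot>\<^sub>v ?h 1 = 0\<^sub>v ?d" for a b
  proof -
    let ?r = "complex_of_real (1 / sqrt (real (L + 1)))"
    have r: "?r \<noteq> 0" by (simp del: of_nat_Suc)
    \<comment> \<open>At clock value 0 a history state is a nonzero multiple of its input, so a
      dependence would carry over to the two basis vectors.\<close>
    have "clock_slice (2 ^ n) (L + 1) (a \<cdot>\<^sub>v ?h 0 + b \<cdot>\<^sub>v ?h 1) 0 = 0\<^sub>v (2 ^ n)"
      unfolding that by (rule clock_slice_zero) simp
    then have eq: "a \<cdot>\<^sub>v (?r \<cdot>\<^sub>v ?e 0) + b \<cdot>\<^sub>v (?r \<cdot>\<^sub>v ?e 1) = 0\<^sub>v (2 ^ n)"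
      using h(1)[of 0] h(1)[of 1]
      by (simp only: clock_slice_add clock_slice_smult history_state_0_slice[OF e] smult_carrier_vec
          clock_pos)
    have "a * ?r = 0" using arg_cong[OF eq, of "\<lambda>v. v $ 0"] one_less by simp
    moreover have "b * ?r = 0" using arg_cong[OF eq, of "\<lambda>v. v $ 1"] one_less by simp
    ultimately show ?thesis using r by simp
  qed
  have "kernel_dim (H_prop n L U) > 1"
  proof (rule kernel_dim_gt_1I[OF H])
    show "?h 0 \<in> mat_kernel (H_prop n L U)" "?h 1 \<in> mat_kernel (H_prop n L U)"
      using h by (auto intro: mat_kernelI[OF H])
  qed (fact indep)
  moreover have "?h 0 \<noteq> 0\<^sub>v ?d"
    using history_state_norm[OF e, of 0] by auto
  then have "lowest_eigenvalue (H_prop n L U) 0"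
    by (intro psd_mat_lowest_eigenvalue(2)[OF psd_mat_H_prop h(1) _ h(2)])
  ultimately show ?thesis
    using char_matrix_0[OF H] by (auto simp: degenerate_ground_space_def intro!: exI[of _ 0])
qed

end

section \<open>The input term and the combined Hamiltonian\<close>

lemma psd_mat_H_in:
  assumes V: "unitary_mat (2 ^ n) V"
  shows "psd_mat (2 ^ n * (L + 1)) (H_in n L V)"
    and "w \<in> carrier_vec (2 ^ n * (L + 1)) \<Longrightarrow> H_in n L V *\<^sub>v w = 0\<^sub>v (2 ^ n * (L + 1)) \<longleftrightarrow>
      (\<exists>c. clock_slice (2 ^ n) (L + 1) w 0 = c \<cdot>\<^sub>v (V *\<^sub>v unit_vec (2 ^ n) 0))"
proof -
  let ?P = "msum (2 ^ n) (P1 n) {1..n}" and ?e = "unit_vec (2 ^ n) 0 :: complex vec"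
  have P: "psd_mat (2 ^ n) ?P" by (rule psd_mat_msum) (auto intro: psd_mat_P1)
  have VPV: "psd_mat (2 ^ n) (V * ?P * mat_adjoint V)" by (rule psd_mat_conj(1)[OF P V])
  have Vc: "V \<in> carrier_mat (2 ^ n) (2 ^ n)" "mat_adjoint V \<in> carrier_mat (2 ^ n) (2 ^ n)"
    "mat_adjoint V * V = 1\<^sub>m (2 ^ n)" "V * mat_adjoint V = 1\<^sub>m (2 ^ n)"
    using V mat_adjoint_carrier by (auto simp: unitary_mat_def)
  show "psd_mat (2 ^ n * (L + 1)) (H_in n L V)"
    unfolding H_in_def by (rule psd_mat_kron_ketbra(1)[OF VPV]) simp
  show "H_in n L V *\<^sub>v w = 0\<^sub>v (2 ^ n * (L + 1)) \<longleftrightarrow>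
      (\<exists>c. clock_slice (2 ^ n) (L + 1) w 0 = c \<cdot>\<^sub>v (V *\<^sub>v ?e))"
    if w: "w \<in> carrier_vec (2 ^ n * (L + 1))"
  proof -
    define x where "x = clock_slice (2 ^ n) (L + 1) w 0"
    have x: "x \<in> carrier_vec (2 ^ n)" by (simp add: x_def)
    let ?y = "mat_adjoint V *\<^sub>v x"
    have y: "?y \<in> carrier_vec (2 ^ n)" using Vc x by simp
    \<comment> \<open>The clock projector leaves only slice 0, and undoing the conjugation by
      \<open>V\<close> leaves the bare sum of the \<open>P1 n i\<close>.\<close>
    have "H_in n L V *\<^sub>v w = 0\<^sub>v (2 ^ n * (L + 1)) \<longleftrightarrow> ?P *\<^sub>v ?y = 0\<^sub>v (2 ^ n)"
      unfolding H_in_def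
      using psd_mat_kron_ketbra(2)[OF VPV _ w, of 0] psd_mat_conj(2)[OF P V x] by (simp add: x_def)
    also have "\<dots> \<longleftrightarrow> ?y = ?y $ 0 \<cdot>\<^sub>v ?e"
      using psd_mat_msum(2)[of "{1..n}" "2 ^ n" "P1 n", OF _ psd_mat_P1 y] P1_kernel[OF y] by simp
    also have "\<dots> \<longleftrightarrow> (\<exists>c. x = c \<cdot>\<^sub>v (V *\<^sub>v ?e))"
    proof
      assume eq: "?y = ?y $ 0 \<cdot>\<^sub>v ?e"
      have "x = V *\<^sub>v ?y" using Vc x by (simp flip: assoc_mult_mat_vec[of _ "2 ^ n" "2 ^ n"])
      also have "\<dots> = ?y $ 0 \<cdot>\<^sub>v (V *\<^sub>v ?e)" by (subst eq) (simp add: mult_mat_vec[OF Vc(1)])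
      finally show "\<exists>c. x = c \<cdot>\<^sub>v (V *\<^sub>v ?e)" by blast
    next
      assume "\<exists>c. x = c \<cdot>\<^sub>v (V *\<^sub>v ?e)"
      then obtain c where c: "x = c \<cdot>\<^sub>v (V *\<^sub>v ?e)" by blast
      have "mat_adjoint V *\<^sub>v (V *\<^sub>v ?e) = ?e"
        using Vc by (simp flip: assoc_mult_mat_vec[of _ "2 ^ n" "2 ^ n"])
      then have "?y = c \<cdot>\<^sub>v ?e"
        unfolding c using mult_mat_vec[OF Vc(2), of "V *\<^sub>v ?e" c] Vc by simp
      \<comment> \<open>Reading off entry 0 identifies \<open>c\<close> with
        \<open>?y $ 0\<close>.\<close>
      then show "?y = ?y $ 0 \<cdot>\<^sub>v ?e" by simp
    qed
    finally show ?thesis by (simp add: x_def)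
  qed
qed

lemma nondegenerate_history_state:
  assumes U: "\<And>t. t \<in> {1..L} \<Longrightarrow> unitary_mat (2 ^ n) (U t)"
    and V: "unitary_mat (2 ^ n) V" and J: "J > 0" and K: "K > 0"
  shows "nondegenerate_ground_state
    (complex_of_real J \<cdot>\<^sub>m H_in n L V + complex_of_real K \<cdot>\<^sub>m H_prop n L U)
    (history_state n L U (V *\<^sub>v tensor_power_vec (unit_vec 2 0) n))"
proof -
  let ?d = "2 ^ n * (L + 1)" and ?e = "unit_vec (2 ^ n) 0 :: complex vec"
  define H where "H = complex_of_real J \<cdot>\<^sub>m H_in n L V + complex_of_real K \<cdot>\<^sub>m H_prop n L U"
  define \<phi> where "\<phi> = V *\<^sub>v ?e"
  define \<psi> where "\<psi> = history_state n L U \<phi>"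
  have \<phi>: "\<phi> \<in> carrier_vec (2 ^ n)" using V by (auto simp: \<phi>_def unitary_mat_def)
  note Hi = psd_mat_H_in[OF V, where L = L]
  have Hp: "psd_mat ?d (H_prop n L U)" using U by (rule psd_mat_H_prop)
  have psd: "psd_mat ?d H"
    unfolding H_def by (intro psd_mat_add(1) psd_mat_smult(1) Hi Hp J K)
  note Hc = psd_matD(1)[OF psd]
  \<comment> \<open>The first conjunct is the kernel of \<open>H_in\<close>: it fixes slice 0 up to
    a scalar, and the second conjunct propagates it to all later slices.\<close>
  have ker: "H *\<^sub>v w = 0\<^sub>v ?d \<longleftrightarrow>
      (\<exists>c. clock_slice (2 ^ n) (L + 1) w 0 = c \<cdot>\<^sub>v \<phi>) \<and> H_prop n L U *\<^sub>v w = 0\<^sub>v ?d"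
    if w: "w \<in> carrier_vec ?d" for w
    unfolding H_def \<phi>_def Hi(2)[OF w, symmetric]
    by (subst psd_mat_add(2)[OF psd_mat_smult(1)[OF Hi(1) J] psd_mat_smult(1)[OF Hp K] w])
      (simp only: psd_mat_smult(2)[OF Hi(1) J w] psd_mat_smult(2)[OF Hp K w])
  have \<psi>: "\<psi> \<in> carrier_vec ?d"
    unfolding \<psi>_def by (rule history_state_carrier_slice(1)[of L n U, OF U \<phi>])
  have "\<psi> \<bullet>c \<psi> = \<phi> \<bullet>c \<phi>"
    unfolding \<psi>_def by (rule history_state_norm[of L n U, OF U \<phi>])
  also have "\<dots> = 1" unfolding \<phi>_def by (subst unitary_mat_cscalar_prod[OF V]) auto
  finally have norm: "\<psi> \<bullet>c \<psi> = 1" .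
  then have \<psi>0: "\<psi> \<noteq> 0\<^sub>v ?d" by auto
  have H\<psi>: "H *\<^sub>v \<psi> = 0\<^sub>v ?d"
    unfolding ker[OF \<psi>] using H_prop_history_state[of L n U, OF U \<phi>] history_state_0_slice[of L n U, OF U \<phi>]
    by (auto simp: \<psi>_def)
  have "kernel_dim H = 1"
  proof (rule kernel_dim_eq_1I[OF Hc _ \<psi>0])
    show "\<psi> \<in> mat_kernel H" using \<psi> H\<psi> by (rule mat_kernelI[OF Hc])
    fix w assume "w \<in> mat_kernel H"
    then have w: "w \<in> carrier_vec ?d" "H *\<^sub>v w = 0\<^sub>v ?d" using mat_kernelD[OF Hc] by auto
    then obtain c where "clock_slice (2 ^ n) (L + 1) w 0 = c \<cdot>\<^sub>v \<phi>" "H_prop n L U *\<^sub>v w = 0\<^sub>v ?d"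
      using ker by auto
    then show "\<exists>c. w = c \<cdot>\<^sub>v \<psi>"
      unfolding \<psi>_def using H_prop_kernel_eq_history_state[of L n U, OF U w(1) \<phi>] by blast
  qed
  then have "nondegenerate_ground_state H \<psi>"
    using norm psd_mat_lowest_eigenvalue[OF psd \<psi> \<psi>0 H\<psi>] char_matrix_0[OF Hc]
    by (auto simp: nondegenerate_ground_state_def intro!: exI[of _ 0])
  then show ?thesis by (simp only: H_def \<psi>_def \<phi>_def tensor_power_unit_vec_0)
qed

text \<open>The first conjunct shows that there is a degeneracy to lift. It is guarded by
  \<open>n \<ge> 1\<close> since for \<open>n = 0\<close> the register is one-dimensional and the
  propagation kernel is already a line.\<close>

theorem lemma3:
  fixes n L :: nat and U :: "nat \<Rightarrow> complex mat" and V :: "complex mat"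
  assumes U: "\<And>t. t \<in> {1..L} \<Longrightarrow> unitary_mat (2 ^ n) (U t)"
    and V: "unitary_mat (2 ^ n) V"
  shows "(n \<ge> 1 \<longrightarrow> degenerate_ground_space (H_prop n L U)) \<and>
    (\<forall>J K :: real. J > 0 \<longrightarrow> K > 0 \<longrightarrow>
       nondegenerate_ground_state
         (complex_of_real J \<cdot>\<^sub>m H_in n L V + complex_of_real K \<cdot>\<^sub>m H_prop n L U)
         (history_state n L U (V *\<^sub>v tensor_power_vec (unit_vec 2 0) n)))"
  using degenerate_H_prop[of L n U] nondegenerate_history_state[of L n U V] U V by blast

end
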